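(* Let $\mu$ be a full Borel probability measure on the Cantor space $2^{\mathbb{N}}$. Then $\mu$ is good if and only if $\mu$ is both ultrahomogeneous and maximal.
   Context: All measures are Borel probability measures; $2^{\mathbb{N}}$ is the Cantor space. A measure is full if it is positive on every nonempty open set. $V_\mu=\{\mu(U): U\subseteq 2^{\mathbb{N}}\text{ clopen}\}$ is the clopen values set of $\mu$. A full measure $\mu$ on $2^{\mathbb{N}}$ is good if it satisfies the Subset Condition: whenever $U,V$ are clopen with $\mu(U)<\mu(V)$, there is a clopen $W\subseteq V$ with $\mu(W)=\mu(U)$ (such a measure is automatically nonatomic). $\mathrm{Homeo}(2^{\mathbb{N}},\mu)$ is the group of homeomorphisms of $2^{\mathbb{N}}$ preserving $\mu$. A clopen partition is a finite partition of $2^{\mathbb{N}}$ into nonempty clopen sets. A full measure $\mu$ is ultrahomogeneous if for any clopen partitions $P,R$ and any bijection $f\colon P\to R$ with $\mu(x)=\mu(f(x))$ for all $x\in P$, there is $\varphi\in\mathrm{Homeo}(2^{\mathbb{N}},\mu)$ with $\varphi[x]=f(x)$ for every $x\in P$. A measure $\mu$ is maximal if (i) for every tuple $v_1,\dots,v_n$ of non-zero elements of $V_\mu$ with $\sum_{i=1}^n v_i=1$ there is a clopen partition $\{x_1,\dots,x_n\}$ of $2^{\mathbb{N}}$ with $\mu(x_i)=v_i$ for $1\le i\le n$, and (ii) $|v-w|\in V_\mu$ for all $v,w\in V_\mu$. *)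

theory Defs
  imports "HOL-Probability.Probability"
begin

text \<open>
  The Cantor space is the type \<^typ>\<open>nat \<Rightarrow> bool\<close>, whose topology is the product of the discrete
  topologies on \<^typ>\<open>bool\<close>.
\<close>

type_synonym cantor = "nat \<Rightarrow> bool"

definition borel_prob :: "cantor measure \<Rightarrow> bool" where
  "borel_prob M \<longleftrightarrow> prob_space M \<and> sets M = sets borel"

definition full_measure :: "cantor measure \<Rightarrow> bool" where
  "full_measure M \<longleftrightarrow> borel_prob M \<and> (\<forall>U. open U \<and> U \<noteq> {} \<longrightarrow> measure M U > 0)"

definition clopen :: "cantor set \<Rightarrow> bool" where
  "clopen U \<longleftrightarrow> open U \<and> closed U"

definition clopen_values :: "cantor measure \<Rightarrow> real set" where
  "clopen_values M = {measure M U | U. clopen U}"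

definition clopen_partition :: "cantor set set \<Rightarrow> bool" where
  "clopen_partition P \<longleftrightarrow> finite P \<and> partition_on UNIV P \<and> (\<forall>x\<in>P. clopen x)"

definition homeo :: "cantor measure \<Rightarrow> (cantor \<Rightarrow> cantor) set" where
  "homeo M = {\<phi>. (\<exists>\<psi>. homeomorphism UNIV UNIV \<phi> \<psi>) \<and> distr M M \<phi> = M}"

definition good :: "cantor measure \<Rightarrow> bool" where
  "good M \<longleftrightarrow> full_measure M \<and>
     (\<forall>U V. clopen U \<and> clopen V \<and> measure M U < measure M V \<longrightarrow>
        (\<exists>W. clopen W \<and> W \<subseteq> V \<and> measure M W = measure M U))"

definition ultrahomogeneous :: "cantor measure \<Rightarrow> bool" where
  "ultrahomogeneous M \<longleftrightarrow> full_measure M \<and>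
     (\<forall>P R f. clopen_partition P \<and> clopen_partition R \<and> bij_betw f P R \<and>
        (\<forall>x\<in>P. measure M x = measure M (f x)) \<longrightarrow>
        (\<exists>\<phi>\<in>homeo M. \<forall>x\<in>P. \<phi> ` x = f x))"

text \<open>
  A tuple of length \<open>n\<close> is a function restricted to the indices \<open>1..n\<close>; injectivity says that
  \<open>{x 1, \<dots>, x n}\<close> lists each cell of the partition once.
\<close>

definition maximal :: "cantor measure \<Rightarrow> bool" where
  "maximal M \<longleftrightarrow> borel_prob M \<and>
     (\<forall>(n::nat) v. (\<forall>i\<in>{1..n}. v i \<in> clopen_values M \<and> v i \<noteq> 0) \<and> (\<Sum>i=1..n. v i) = 1 \<longrightarrow>
        (\<exists>x. inj_on x {1..n} \<and> clopen_partition (x ` {1..n}) \<and>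
             (\<forall>i\<in>{1..n}. measure M (x i) = v i))) \<and>
     (\<forall>v\<in>clopen_values M. \<forall>w\<in>clopen_values M. \<bar>v - w\<bar> \<in> clopen_values M)"

end

theory Submission
  imports Defs
begin

text \<open>
  Ultrahomogeneity of a good measure is proved by back and forth. A state is a pair of maps
  \<open>\<alpha>, \<beta>\<close> from the Cantor space to \<open>nat\<close> with clopen fibres such that fibres over the same label
  have the same measure. By the Subset Condition a clopen splitting of the fibres of \<open>\<alpha>\<close> can be
  copied to the fibres of \<open>\<beta>\<close>, and vice versa, so there is a sequence of refining states that
  separates points on both sides. The homeomorphism sends \<open>x\<close> to the unique \<open>y\<close> carrying the same
  labels, which exists by compactness. Maximality follows by cutting off one clopen piece at a
  time. Conversely, given \<open>\<mu> U < \<mu> V\<close>, maximality yields clopen cells of measures \<open>\<mu> U\<close>,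
  \<open>\<mu> V - \<mu> U\<close> and \<open>1 - \<mu> V\<close>, and ultrahomogeneity moves the union of the first two onto \<open>V\<close>.
\<close>

section \<open>Topology of the Cantor space\<close>

instance bool :: second_countable_topology
proof
  have "generate_topology UNIV = (open :: bool set \<Rightarrow> bool)"
    by (auto simp: fun_eq_iff Topological_Spaces.open_discrete intro: generate_topology.Basis)
  then show "\<exists>B :: bool set set. countable B \<and> open = generate_topology B"
    by (intro exI[of _ UNIV]) auto
qed

lemma clopen_simps [simp, intro]:
  "clopen {}" "clopen UNIV"
  "clopen U \<Longrightarrow> clopen V \<Longrightarrow> clopen (U \<inter> V)"
  "clopen U \<Longrightarrow> clopen V \<Longrightarrow> clopen (U \<union> V)"
  "clopen U \<Longrightarrow> clopen V \<Longrightarrow> clopen (U - V)"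
  "clopen U \<Longrightarrow> clopen (- U)"
  by (auto simp: clopen_def)

text \<open>A preimage is a union of fibres, hence open; its complement is the preimage of the
  complement of \<open>B\<close>, hence open as well.\<close>

lemma open_fibres_clopen_vimage:
  fixes f :: "cantor \<Rightarrow> 'b"
  assumes "\<And>l. open (f -` {l})"
  shows "clopen (f -` B)"
proof -
  have "open (f -` B)" for B
  proof -
    have "f -` B = (\<Union>l\<in>B. f -` {l})" by auto
    then show ?thesis using assms by (metis open_UN)
  qed
  then show ?thesis
    by (simp add: clopen_def closed_def flip: vimage_Compl)
qed

lemma clopen_coordinate: "clopen {x :: cantor. x n}"
proof -
  have "open ((\<lambda>x::cantor. x n) -` {l})" for l
    by (intro open_vimage Topological_Spaces.open_discrete continuous_on_product_coordinates)
  from open_fibres_clopen_vimage[OF this, of "{True}"] show ?thesis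
    by (simp add: vimage_def)
qed

lemma compact_cantor: "compact (UNIV :: cantor set)"
proof -
  have "compact_space (product_topology (\<lambda>i::nat. euclidean :: bool topology) UNIV)"
    unfolding compact_space_product_topology
    by (simp add: compact_space_def finite_imp_compact)
  then show ?thesis
    by (simp add: compact_space_def euclidean_product_topology)
qed

section \<open>Full measures and clopen sets\<close>

context
  fixes M :: "cantor measure"
  assumes full: "full_measure M"
begin

lemma full_prob: "prob_space M" and full_sets: "sets M = sets borel" and full_space: "space M = UNIV"
  and full_pos: "open U \<Longrightarrow> U \<noteq> {} \<Longrightarrow> measure M U > 0"
proof -
  show "prob_space M" and s: "sets M = sets borel" and "open U \<Longrightarrow> U \<noteq> {} \<Longrightarrow> measure M U > 0"
    using full by (auto simp: full_measure_def borel_prob_def)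
  show "space M = UNIV"
    using sets_eq_imp_space_eq[OF s] by simp
qed

interpretation prob_space M by (rule full_prob)

lemma clopen_in_sets: "clopen U \<Longrightarrow> U \<in> sets M"
  by (simp add: full_sets clopen_def)

lemma measure_UNIV: "measure M UNIV = 1"
  using prob_space full_space by simp

lemma clopen_measure_eq_0_iff: "clopen U \<Longrightarrow> measure M U = 0 \<longleftrightarrow> U = {}"
  using full_pos[of U] by (metis clopen_def less_irrefl measure_empty)

text \<open>The Subset Condition covers strict inequality; in the case of equality \<open>V\<close>
  itself serves as \<open>W\<close>.\<close>

lemma good_subset_le:
  assumes "good M" "clopen U" "clopen V" "measure M U \<le> measure M V"
  obtains W where "clopen W" "W \<subseteq> V" "measure M W = measure M U"
  using assms unfolding good_def by (metis order_refl le_less)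

subsection \<open>Back and forth\<close>

text \<open>Common labels encode a measure-preserving correspondence between the cells of two clopen
  partitions. Fibres may be empty, so splitting off an empty or a full piece needs no special
  case.\<close>

definition matched :: "(cantor \<Rightarrow> nat) \<Rightarrow> (cantor \<Rightarrow> nat) \<Rightarrow> bool" where
  "matched \<alpha> \<beta> \<longleftrightarrow> (\<forall>l. clopen (\<alpha> -` {l}) \<and> clopen (\<beta> -` {l}) \<and>
     measure M (\<alpha> -` {l}) = measure M (\<beta> -` {l}))"

lemma matched_sym: "matched \<alpha> \<beta> \<Longrightarrow> matched \<beta> \<alpha>"
  by (simp add: matched_def)

text \<open>One half of a back-and-forth step. Each label gets a new lowest bit: on the
  \<open>\<alpha>\<close> side it records membership in \<open>D\<close>, on the
  \<open>\<beta>\<close> side membership in a clopen copy, inside the fibre, of the part of the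
  \<open>\<alpha>\<close> fibre in \<open>D\<close>. The remainders match by subtraction.\<close>

lemma matched_split:
  assumes good: "good M" and m: "matched \<alpha> \<beta>" and D: "clopen D"
  obtains \<alpha>' \<beta>' where "matched \<alpha>' \<beta>'" "\<And>x. \<alpha>' x div 2 = \<alpha> x" "\<And>y. \<beta>' y div 2 = \<beta> y"
    "\<And>x. odd (\<alpha>' x) \<longleftrightarrow> x \<in> D"
proof -
  have ml: "clopen (\<alpha> -` {l})" "clopen (\<beta> -` {l})" "measure M (\<alpha> -` {l}) = measure M (\<beta> -` {l})" for l
    using m unfolding matched_def by blast+
  have "\<exists>W. clopen W \<and> W \<subseteq> \<beta> -` {l} \<and> measure M W = measure M (\<alpha> -` {l} \<inter> D)" for l
  proof -
    have "measure M (\<alpha> -` {l} \<inter> D) \<le> measure M (\<alpha> -` {l})"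
      by (rule finite_measure_mono) (simp_all add: ml clopen_in_sets)
    moreover have "clopen (\<alpha> -` {l} \<inter> D)" using ml D by simp
    ultimately show ?thesis
      using good_subset_le[OF good _ ml(2)] ml(3) by metis
  qed
  then obtain W where W: "\<And>l. clopen (W l)" "\<And>l. W l \<subseteq> \<beta> -` {l}"
    "\<And>l. measure M (W l) = measure M (\<alpha> -` {l} \<inter> D)" by metis
  \<comment> \<open>Digit arithmetic used to identify the fibres of the new labellings.\<close>
  have bits: "2 * p + of_bool c = 2 * q + 1 \<longleftrightarrow> p = q \<and> c" "2 * p + of_bool c = 2 * q \<longleftrightarrow> p = q \<and> \<not> c"
    for p q :: nat and c
    by (cases c; simp; presburger)+
  define \<alpha>' where "\<alpha>' x = 2 * \<alpha> x + of_bool (x \<in> D)" for x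
  define \<beta>' where "\<beta>' y = 2 * \<beta> y + of_bool (y \<in> W (\<beta> y))" for y
  have "clopen (\<alpha>' -` {k}) \<and> clopen (\<beta>' -` {k}) \<and> measure M (\<alpha>' -` {k}) = measure M (\<beta>' -` {k})" for k
  proof -
    define l where "l = k div 2"
    show ?thesis
    proof (cases "odd k")
      case True
      then have k: "k = 2 * l + 1" by (simp add: l_def)
      have "\<alpha>' -` {k} = \<alpha> -` {l} \<inter> D"
        unfolding \<alpha>'_def k set_eq_iff vimage_eq singleton_iff bits by blast
      moreover have "\<beta>' -` {k} = W l"
        using W(2) unfolding \<beta>'_def k set_eq_iff vimage_eq singleton_iff bits by blast
      ultimately show ?thesis using W ml D by simp
    next
      case False
      then have k: "k = 2 * l" by (simp add: l_def)
      \<comment> \<open>The remainder is written as the fibre minus a subset of it, so that both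
        measures are differences.\<close>
      have "\<alpha>' -` {k} = \<alpha> -` {l} - \<alpha> -` {l} \<inter> D"
        unfolding \<alpha>'_def k set_eq_iff vimage_eq singleton_iff bits by blast
      moreover have "\<beta>' -` {k} = \<beta> -` {l} - W l"
        unfolding \<beta>'_def k set_eq_iff vimage_eq singleton_iff Diff_iff bits by blast
      moreover have "measure M (\<alpha> -` {l} - \<alpha> -` {l} \<inter> D) = measure M (\<beta> -` {l} - W l)"
        using W ml D by (simp add: clopen_in_sets finite_measure_Diff)
      ultimately show ?thesis using W ml D by simp
    qed
  qed
  then have "matched \<alpha>' \<beta>'" by (simp add: matched_def)
  then show ?thesis
    by (rule that) (auto simp: \<alpha>'_def \<beta>'_def)
qed

text \<open>Coordinate \<open>n\<close> is decided on the \<open>\<beta>\<close> side first, with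
  the roles exchanged, and then on the \<open>\<alpha>\<close> side. The bit of the
  \<open>\<beta>\<close> side is therefore the second lowest one, which explains the
  \<open>div 2\<close> in the last clause.\<close>

lemma matched_step:
  assumes good: "good M" and m: "matched \<alpha> \<beta>"
  obtains \<alpha>' \<beta>' where "matched \<alpha>' \<beta>'" "\<And>x. \<alpha>' x div 2 div 2 = \<alpha> x" "\<And>y. \<beta>' y div 2 div 2 = \<beta> y"
    "\<And>x. odd (\<alpha>' x) \<longleftrightarrow> x n" "\<And>y. odd (\<beta>' y div 2) \<longleftrightarrow> y n"
proof -
  obtain \<alpha>1 \<beta>1 where 1: "matched \<beta>1 \<alpha>1" "\<And>x. \<alpha>1 x div 2 = \<alpha> x" "\<And>y. \<beta>1 y div 2 = \<beta> y"
    "\<And>x. odd (\<beta>1 x) \<longleftrightarrow> x n"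
    using matched_split[OF good matched_sym[OF m] clopen_coordinate[of n]]
    unfolding mem_Collect_eq by metis
  obtain \<alpha>2 \<beta>2 where 2: "matched \<alpha>2 \<beta>2" "\<And>x. \<alpha>2 x div 2 = \<alpha>1 x" "\<And>y. \<beta>2 y div 2 = \<beta>1 y"
    "\<And>x. odd (\<alpha>2 x) \<longleftrightarrow> x n"
    using matched_split[OF good matched_sym[OF 1(1)] clopen_coordinate[of n]]
    unfolding mem_Collect_eq by metis
  show ?thesis by (rule that[OF 2(1)]) (simp_all only: 1 2)
qed

text \<open>The value \<open>\<phi> x\<close> is taken from the intersection of the nested
  \<open>b\<close> fibres over the labels of \<open>x\<close>, nonempty by compactness. Coordinate
  \<open>n\<close> of \<open>\<phi> x\<close> depends only on \<open>a (Suc n) x\<close>, whence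
  continuity. The map \<open>r\<close> recovers each label from the next one.\<close>

lemma matched_transfer:
  assumes m: "\<And>n. matched (a n) (b n)"
    and ra: "\<And>n x. r (a (Suc n) x) = a n x" and rb: "\<And>n x. r (b (Suc n) x) = b n x"
    and sep: "\<And>n x y. b (Suc n) x = b (Suc n) y \<Longrightarrow> x n = y n"
  shows "\<exists>\<phi>. continuous_on UNIV \<phi> \<and> (\<forall>n x. b n (\<phi> x) = a n x)"
proof -
  have "\<exists>y. \<forall>n. b n y = a n x" for x
  proof -
    define K where "K n = b n -` {a n x}" for n
    have "UNIV \<inter> \<Inter>(range K) \<noteq> {}"
    proof (rule compact_imp_fip[OF compact_cantor])
      fix T assume "T \<in> range K"
      then show "closed T" using m by (auto simp: K_def matched_def clopen_def)
    next
      fix F assume "finite F" "F \<subseteq> range K"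
      then obtain N where N: "finite N" "F = K ` N" by (meson finite_subset_image)
      have "K (Suc n) \<subseteq> K n" for n
        unfolding K_def using ra rb by (metis (mono_tags) subsetI vimage_singleton_eq)
      then have dec: "m \<le> n \<Longrightarrow> K n \<subseteq> K m" for m n
        by (rule lift_Suc_antimono_le)
      \<comment> \<open>Inserting 0 keeps the maximum defined when \<open>N\<close> is
        empty.\<close>
      define k where "k = Max (insert 0 N)"
      \<comment> \<open>This fibre contains \<open>x\<close>; the matching fibre of
        \<open>b k\<close> has the same measure, so it is nonempty because \<open>M\<close> is
        full.\<close>
      have "a k -` {a k x} \<noteq> {}" by auto
      then have "K k \<noteq> {}"
        using m[of k] unfolding K_def matched_def by (metis clopen_measure_eq_0_iff)
      moreover have "n \<le> k" if "n \<in> N" for n using N(1) that by (simp add: k_def)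
      then have "K k \<subseteq> \<Inter>F" using N(2) dec by blast
      ultimately show "UNIV \<inter> \<Inter>F \<noteq> {}" by auto
    qed
    then show ?thesis by (auto simp: K_def)
  qed
  then obtain \<phi> where \<phi>: "\<And>n x. b n (\<phi> x) = a n x" by metis
  have "continuous_on UNIV \<phi>"
  proof (rule continuous_on_coordinatewise_then_product)
    fix n
    have "open ((\<lambda>x. \<phi> x n) -` B)" for B
    proof -
      \<comment> \<open>The preimage of \<open>B\<close> is thus a union of fibres of
        \<open>a (Suc n)\<close>, and these are open.\<close>
      have "\<phi> x n = \<phi> y n" if "a (Suc n) x = a (Suc n) y" for x y
        using sep[of n "\<phi> x" "\<phi> y"] that by (simp add: \<phi>)
      then have "a (Suc n) -` (a (Suc n) ` ((\<lambda>x. \<phi> x n) -` B)) = (\<lambda>x. \<phi> x n) -` B"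
        by blast
      moreover have "clopen (a (Suc n) -` (a (Suc n) ` ((\<lambda>x. \<phi> x n) -` B)))"
        by (rule open_fibres_clopen_vimage) (use m[of "Suc n"] in \<open>simp add: matched_def clopen_def\<close>)
      ultimately show ?thesis unfolding clopen_def by metis
    qed
    then show "continuous_on UNIV (\<lambda>x. \<phi> x n)"
      by (simp add: continuous_on_open_vimage)
  qed
  then show ?thesis using \<phi> by blast
qed

text \<open>Coordinate \<open>n\<close> is determined by the label \<open>b (Suc n)\<close>, and
  there are only countably many labels. The empty set is added to make the generator stable under
  intersection.\<close>

lemma sets_eq_sigma_fibres:
  assumes m: "\<And>n. matched (a n) (b n)"
    and sep: "\<And>n x y. b (Suc n) x = b (Suc n) y \<Longrightarrow> x n = y n"
  shows "sets M = sigma_sets UNIV (insert {} {b n -` {l} | n l. True})" (is "_ = sigma_sets UNIV ?E")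
proof
  have op: "open (b n -` {l})" for n l using m by (auto simp: matched_def clopen_def)
  show "sigma_sets UNIV ?E \<subseteq> sets M"
    unfolding full_sets
    by (rule sets.sigma_sets_subset'[where M=borel, simplified]) (use op in auto)
  let ?S = "sigma UNIV ?E"
  \<comment> \<open>Measurability of the identity says that every Borel set lies in
    \<open>?S\<close>. Checking coordinates suffices since \<open>bool\<close> is second
    countable.\<close>
  have "(\<lambda>y::cantor. y) \<in> borel_measurable ?S"
  proof (rule measurable_coordinatewise_then_product)
    fix n
    have "{y. y n \<in> B} \<in> sets ?S" for B
    proof -
      have "{y. y n \<in> B} = (\<Union>l\<in>b (Suc n) ` {y. y n \<in> B}. b (Suc n) -` {l})"
      proof (intro equalityI subsetI)
        fix y assume "y \<in> (\<Union>l\<in>b (Suc n) ` {y. y n \<in> B}. b (Suc n) -` {l})"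
        then obtain z where "z n \<in> B" "b (Suc n) y = b (Suc n) z" by blast
        then show "y \<in> {y. y n \<in> B}" using sep[of n y z] by simp
      qed blast
      moreover have "\<dots> \<in> sets ?S"
      proof (rule sets.countable_UN'')
        show "b (Suc n) -` {l} \<in> sets ?S" for l by (rule in_measure_of) auto
      qed simp
      ultimately show ?thesis by simp
    qed
    then show "(\<lambda>y::cantor. y n) \<in> borel_measurable ?S"
      by (intro measurableI) (auto simp: vimage_def)
  qed
  then have "B \<in> sets ?S" if "B \<in> sets borel" for B :: "cantor set"
    using measurable_sets[of "\<lambda>y::cantor. y" ?S borel B] that by simp
  then show "sets M \<subseteq> sigma_sets UNIV ?E" by (auto simp: full_sets)
qed

text \<open>Transferring labels both ways gives continuous maps that are mutually inverse because
  labels separate points. The measure is preserved because it is preserved on the fibres, an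
  intersection-stable generator of the Borel sets.\<close>

lemma matched_limit:
  assumes m: "\<And>n. matched (a n) (b n)"
    and ra: "\<And>n x. r (a (Suc n) x) = a n x" and rb: "\<And>n x. r (b (Suc n) x) = b n x"
    and sa: "\<And>n x y. a (Suc n) x = a (Suc n) y \<Longrightarrow> x n = y n"
    and sb: "\<And>n x y. b (Suc n) x = b (Suc n) y \<Longrightarrow> x n = y n"
  shows "\<exists>\<phi>\<in>homeo M. \<forall>x. b 0 (\<phi> x) = a 0 x"
proof -
  have "\<exists>\<phi>. continuous_on UNIV \<phi> \<and> (\<forall>n x. b n (\<phi> x) = a n x)"
    by (rule matched_transfer[of a b r]) (fact m ra rb sb)+
  then obtain \<phi> where \<phi>: "continuous_on UNIV \<phi>" "\<And>n x. b n (\<phi> x) = a n x" by blast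
  have "\<exists>\<psi>. continuous_on UNIV \<psi> \<and> (\<forall>n x. a n (\<psi> x) = b n x)"
    by (rule matched_transfer[of b a r]) (fact matched_sym[OF m] ra rb sa)+
  then obtain \<psi> where \<psi>: "continuous_on UNIV \<psi>" "\<And>n x. a n (\<psi> x) = b n x" by blast
  \<comment> \<open>\<open>\<psi> (\<phi> x)\<close> has the same \<open>a\<close> labels as
    \<open>x\<close>, and \<open>\<phi> (\<psi> x)\<close> the same \<open>b\<close> labels.\<close>
  have inv: "\<psi> (\<phi> x) = x" "\<phi> (\<psi> x) = x" for x
    by (rule ext, rule sa[of _ "\<psi> (\<phi> x)" x], simp only: \<phi> \<psi>)
      (rule ext, rule sb[of _ "\<phi> (\<psi> x)" x], simp only: \<phi> \<psi>)
  have "range \<phi> = UNIV" "range \<psi> = UNIV" using inv by (metis surjI)+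
  then have h: "homeomorphism UNIV UNIV \<phi> \<psi>"
    using \<phi>(1) \<psi>(1) inv by (simp add: homeomorphism_def)
  have meas: "\<phi> \<in> measurable M M"
    using borel_measurable_continuous_onI[OF \<phi>(1)] measurable_cong_sets[OF full_sets full_sets] by blast
  let ?E = "insert {} {b n -` {l} | n l. True}"
  have s: "sets M = sigma_sets UNIV ?E"
    by (rule sets_eq_sigma_fibres[of a b]) (fact m sb)+
  have "distr M M \<phi> = M"
  proof (rule measure_eqI_generator_eq)
    \<comment> \<open>Iterating \<open>r\<close> makes every earlier label a function of every later
      one, so two fibres meet in the finer fibre or not at all.\<close>
    have coarsen: "\<exists>q. \<forall>y. b n y = q (b (n + k) y)" for n k
    proof (induction k)
      case (Suc k)
      then obtain q where "\<forall>y. b n y = q (b (n + k) y)" by blast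
      then show ?case by (intro exI[of _ "q \<circ> r"]) (simp add: rb)
    qed (auto intro: exI[of _ id])
    have int: "b n -` {l} \<inter> b n' -` {l'} \<in> ?E" if nn: "n \<le> n'" for n n' l l'
    proof -
      obtain q where "\<And>y. b n y = q (b n' y)"
        using coarsen[of n "n' - n"] nn by auto
      then have "b n -` {l} \<inter> b n' -` {l'} = (if q l' = l then b n' -` {l'} else {})"
        by auto
      then show ?thesis by auto
    qed
    show "Int_stable ?E"
    proof (rule Int_stableI)
      fix X Y assume "X \<in> ?E" "Y \<in> ?E"
      then consider "X \<inter> Y = {}" | n l n' l' where "X = b n -` {l}" "Y = b n' -` {l'}" by auto
      then show "X \<inter> Y \<in> ?E"
      proof cases
        case 2
        then show ?thesis
          using int[of n n' l l'] int[of n' n l' l] by (metis Int_commute nle_le)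
      qed simp
    qed
    show "emeasure (distr M M \<phi>) X = emeasure M X" if XE: "X \<in> ?E" for X
    proof (cases "X = {}")
      case False
      then obtain n l where X: "X = b n -` {l}" using XE by blast
      have c: "clopen X" "measure M (a n -` {l}) = measure M X"
        using m X by (auto simp: matched_def)
      have "\<phi> -` X = a n -` {l}" by (auto simp: X \<phi>)
      then have "emeasure (distr M M \<phi>) X = emeasure M (a n -` {l})"
        using emeasure_distr[OF meas clopen_in_sets[OF c(1)]] full_space by simp
      also have "\<dots> = emeasure M X" using c by (simp add: emeasure_eq_measure)
      finally show ?thesis .
    qed simp
    show "sets (distr M M \<phi>) = sigma_sets UNIV ?E" "sets M = sigma_sets UNIV ?E"
      using s by simp_all
    \<comment> \<open>Uniqueness of measures on a generator asks for a countable cover by generators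
      of finite measure; the fibres of \<open>b 0\<close> provide it.\<close>
    show "range (\<lambda>l. b 0 -` {l}) \<subseteq> ?E" "(\<Union>l. b 0 -` {l}) = UNIV" by auto
    show "emeasure (distr M M \<phi>) (b 0 -` {l}) \<noteq> \<infinity>" for l
      using finite_measure.emeasure_finite[OF finite_measure_distr[OF meas]] by simp
  qed auto
  then have "\<phi> \<in> homeo M" using h by (auto simp: homeo_def)
  then show ?thesis using \<phi>(2) by blast
qed

text \<open>Iterating \<open>matched_step\<close> over all coordinates gives a sequence that
  \<open>matched_limit\<close> turns into a homeomorphism.\<close>

lemma good_matched_homeo:
  assumes good: "good M" and m: "matched \<alpha> \<beta>"
  obtains \<phi> where "\<phi> \<in> homeo M" "\<And>x. \<beta> (\<phi> x) = \<alpha> x"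
proof -
  \<comment> \<open>Clause \<open>n = 0\<close> pins the first state to the given pair, so that the
    limit respects the given labels. In \<open>?Q\<close>, stage \<open>n\<close> decides coordinate
    \<open>n\<close> on both sides.\<close>
  let ?P = "\<lambda>n s. matched (fst s) (snd s) \<and> (n = 0 \<longrightarrow> s = (\<alpha>, \<beta>))"
  let ?Q = "\<lambda>n s s'. (\<forall>x. fst s' x div 2 div 2 = fst s x) \<and> (\<forall>y. snd s' y div 2 div 2 = snd s y) \<and>
    (\<forall>x. odd (fst s' x) \<longleftrightarrow> x n) \<and> (\<forall>y. odd (snd s' y div 2) \<longleftrightarrow> y n)"
  have "\<exists>s. \<forall>n. ?P n (s n) \<and> ?Q n (s n) (s (Suc n))"
  proof (rule dependent_nat_choice)
    show "\<exists>s. ?P 0 s" using m by auto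
    show "\<exists>s'. ?P (Suc n) s' \<and> ?Q n s s'" if P: "?P n s" for n s
    proof -
      obtain \<alpha>' \<beta>' where "matched \<alpha>' \<beta>'" "\<And>x. \<alpha>' x div 2 div 2 = fst s x"
        "\<And>y. \<beta>' y div 2 div 2 = snd s y" "\<And>x. odd (\<alpha>' x) \<longleftrightarrow> x n" "\<And>y. odd (\<beta>' y div 2) \<longleftrightarrow> y n"
        using matched_step[OF good conjunct1[OF P], of n] by blast
      then show ?thesis by (intro exI[of _ "(\<alpha>', \<beta>')"]) simp
    qed
  qed
  then obtain s where s: "\<forall>n. ?P n (s n) \<and> ?Q n (s n) (s (Suc n))" ..
  define a b where "a n = fst (s n)" and "b n = snd (s n)" for n
  have ab: "matched (a n) (b n)" "a (Suc n) x div 2 div 2 = a n x" "b (Suc n) x div 2 div 2 = b n x"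
    "odd (a (Suc n) x) \<longleftrightarrow> x n" "odd (b (Suc n) x div 2) \<longleftrightarrow> x n" for n x
    unfolding a_def b_def using s[rule_format, of n] by blast+
  have ab0: "a 0 = \<alpha>" "b 0 = \<beta>" using s[rule_format, of 0] by (simp_all add: a_def b_def)
  have sa: "x n = y n" if "a (Suc n) x = a (Suc n) y" for n x y using that ab(4) by metis
  have sb: "x n = y n" if "b (Suc n) x = b (Suc n) y" for n x y using that ab(5) by metis
  have "\<exists>\<phi>\<in>homeo M. \<forall>x. b 0 (\<phi> x) = a 0 x"
    by (rule matched_limit[of a b "\<lambda>k. k div 2 div 2"]) (fact ab(1) ab(2) ab(3) sa sb)+
  then show ?thesis using that unfolding ab0 by blast
qed

section \<open>Ultrahomogeneity: from cells to labels and back\<close>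

lemma partition_labelling:
  assumes P: "partition_on UNIV P" and h: "bij_betw h {..<k::nat} P"
  obtains \<alpha> where "\<And>l. \<alpha> -` {l} = (if l < k then h l else {})"
proof -
  have "\<exists>l<k. x \<in> h l" for x
    using P h unfolding partition_on_def bij_betw_def by blast
  then obtain \<alpha> where \<alpha>: "\<And>x. \<alpha> x < k" "\<And>x. x \<in> h (\<alpha> x)" by metis
  have "\<alpha> x = l" if "x \<in> h l" "l < k" for x l
  proof -
    have "h l \<in> P" "h (\<alpha> x) \<in> P" using h that \<alpha> by (auto simp: bij_betw_def)
    then have "h l = h (\<alpha> x)"
      using P that \<alpha>(2)[of x] unfolding partition_on_def disjoint_def by blast
    then show ?thesis using h that \<alpha>(1)[of x] by (auto simp: bij_betw_def inj_on_def)
  qed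
  then have "\<alpha> -` {l} = (if l < k then h l else {})" for l using \<alpha> by auto
  then show ?thesis by (rule that)
qed

lemma good_imp_ultrahomogeneous:
  assumes good: "good M"
  shows "ultrahomogeneous M"
  unfolding ultrahomogeneous_def
proof (intro conjI allI impI full)
  fix P R f
  assume "clopen_partition P \<and> clopen_partition R \<and> bij_betw f P R \<and>
    (\<forall>x\<in>P. measure M x = measure M (f x))"
  then have PR: "finite P" "partition_on UNIV P" "partition_on UNIV R" "bij_betw f P R"
    and cl: "\<And>x. x \<in> P \<Longrightarrow> clopen x" "\<And>x. x \<in> R \<Longrightarrow> clopen x"
    and me: "\<And>x. x \<in> P \<Longrightarrow> measure M x = measure M (f x)"
    by (auto simp: clopen_partition_def)
  obtain h where h: "bij_betw h {..<card P} P"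
    using ex_bij_betw_nat_finite[OF PR(1)] by (auto simp: atLeast0LessThan)
  let ?k = "card P"
  \<comment> \<open>Each cell of \<open>P\<close> and its image under \<open>f\<close> get the same
    index, so a label-preserving map realizes \<open>f\<close>.\<close>
  have fh: "bij_betw (f \<circ> h) {..<?k} R" using h PR(4) by (rule bij_betw_trans)
  obtain \<alpha> where \<alpha>: "\<And>l. \<alpha> -` {l} = (if l < ?k then h l else {})"
    using partition_labelling[OF PR(2) h] by blast
  obtain \<beta> where \<beta>: "\<And>l. \<beta> -` {l} = (if l < ?k then (f \<circ> h) l else {})"
    using partition_labelling[OF PR(3) fh] by blast
  have "h l \<in> P" "f (h l) \<in> R" if "l < ?k" for l
    using h fh that by (auto simp: bij_betw_def)
  then have "matched \<alpha> \<beta>" using cl me by (simp add: matched_def \<alpha> \<beta>)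
  then obtain \<phi> where \<phi>: "\<phi> \<in> homeo M" "\<And>x. \<beta> (\<phi> x) = \<alpha> x"
    using good_matched_homeo[OF good] by blast
  have surj: "surj \<phi>" using \<phi>(1) by (auto simp: homeo_def homeomorphism_def)
  have "\<phi> ` x = f x" if "x \<in> P" for x
  proof -
    have "x \<in> h ` {..<?k}" using bij_betw_imp_surj_on[OF h] that by simp
    then obtain l where l: "l < ?k" "x = h l" by blast
    \<comment> \<open>Preservation of labels gives only a preimage; surjectivity turns it into the
      required image.\<close>
    have "\<alpha> -` {l} = \<phi> -` (\<beta> -` {l})" by (auto simp: \<phi>)
    then have "\<phi> ` (\<alpha> -` {l}) = \<beta> -` {l}" using surj by (metis surj_image_vimage_eq)
    then show ?thesis using l by (simp add: \<alpha> \<beta>)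
  qed
  then show "\<exists>\<phi>\<in>homeo M. \<forall>x\<in>P. \<phi> ` x = f x" using \<phi>(1) by blast
qed

subsection \<open>Maximality\<close>

text \<open>A piece of measure \<open>v (Suc n)\<close> is cut off \<open>V\<close> and the
  induction continues in the rest; hence \<open>V\<close> is kept arbitrary.\<close>

lemma good_clopen_split:
  assumes good: "good M" and "clopen V"
    and "\<forall>i\<in>{1..n::nat}. v i \<in> clopen_values M \<and> v i \<noteq> 0" "(\<Sum>i=1..n. v i) = measure M V"
  shows "\<exists>x. (\<forall>i\<in>{1..n}. clopen (x i) \<and> measure M (x i) = v i) \<and>
    disjoint_family_on x {1..n} \<and> (\<Union>i\<in>{1..n}. x i) = V"
  using assms(2-)
proof (induction n arbitrary: V)
  case 0
  \<comment> \<open>The empty sum forces \<open>V\<close> to be null, hence empty since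
    \<open>M\<close> is full.\<close>
  then show ?case by (auto simp: clopen_measure_eq_0_iff disjoint_family_on_def)
next
  case (Suc n)
  have "v (Suc n) \<in> clopen_values M" using Suc.prems(2) by simp
  then obtain U where U: "clopen U" "v (Suc n) = measure M U"
    by (auto simp: clopen_values_def)
  \<comment> \<open>The other values are nonnegative, so the piece to be cut off is no larger than
    \<open>V\<close>.\<close>
  have "0 \<le> v i" if "i \<in> {1..n}" for i
    using Suc.prems(2)[rule_format, of i] that by (auto simp: clopen_values_def)
  then have "0 \<le> (\<Sum>i=1..n. v i)" by (rule sum_nonneg)
  then have "measure M U \<le> measure M V" using Suc.prems(3) U by simp
  then obtain W where W: "clopen W" "W \<subseteq> V" "measure M W = measure M U"
    using good_subset_le[OF good U(1) Suc.prems(1)] by blast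
  have "(\<Sum>i=1..n. v i) = measure M (V - W)"
    using Suc.prems W U by (simp add: clopen_in_sets finite_measure_Diff)
  moreover have "\<forall>i\<in>{1..n}. v i \<in> clopen_values M \<and> v i \<noteq> 0" using Suc.prems(2) by simp
  moreover have "clopen (V - W)" using Suc.prems(1) W(1) by simp
  ultimately obtain x where x: "\<forall>i\<in>{1..n}. clopen (x i) \<and> measure M (x i) = v i"
    "disjoint_family_on x {1..n}" "(\<Union>i\<in>{1..n}. x i) = V - W"
    using Suc.IH[of "V - W"] by blast
  have 1: "{1..Suc n} = insert (Suc n) {1..n}" by auto
  show ?case
  proof (intro exI conjI)
    let ?x = "x(Suc n := W)"
    show "\<forall>i\<in>{1..Suc n}. clopen (?x i) \<and> measure M (?x i) = v i"
      using x(1) W U by (auto simp: 1)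
    show "disjoint_family_on ?x {1..Suc n}"
      unfolding disjoint_family_on_def
    proof (intro ballI impI)
      fix i j assume ij: "i \<in> {1..Suc n}" "j \<in> {1..Suc n}" "i \<noteq> j"
      have "W \<inter> x k = {}" if "k \<in> {1..n}" for k using x(3) that by blast
      moreover have "x k \<inter> x l = {}" if "k \<in> {1..n}" "l \<in> {1..n}" "k \<noteq> l" for k l
        using x(2) that unfolding disjoint_family_on_def by blast
      ultimately show "?x i \<inter> ?x j = {}"
        using ij unfolding 1 by (cases "i = Suc n"; cases "j = Suc n") (simp_all add: Int_commute)
    qed
    show "(\<Union>i\<in>{1..Suc n}. ?x i) = V"
    proof -
      have "(\<Union>i\<in>{1..n}. ?x i) = (\<Union>i\<in>{1..n}. x i)" by (intro SUP_cong) auto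
      moreover have "(\<Union>i\<in>{1..Suc n}. ?x i) = W \<union> (\<Union>i\<in>{1..n}. ?x i)"
        by (simp only: 1 UN_insert fun_upd_same)
      ultimately show ?thesis using x(3) W(2) by auto
    qed
  qed
qed

lemma good_imp_maximal:
  assumes good: "good M"
  shows "maximal M"
  unfolding maximal_def
proof (intro conjI allI impI ballI)
  show "borel_prob M" using full by (simp add: full_measure_def)
next
  fix n :: nat and v
  assume v: "(\<forall>i\<in>{1..n}. v i \<in> clopen_values M \<and> v i \<noteq> 0) \<and> (\<Sum>i=1..n. v i) = 1"
  then obtain x where x: "\<forall>i\<in>{1..n}. clopen (x i) \<and> measure M (x i) = v i"
    "disjoint_family_on x {1..n}" "(\<Union>i\<in>{1..n}. x i) = UNIV"
    using good_clopen_split[OF good, of UNIV n v] measure_UNIV by auto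
  \<comment> \<open>Nonzero values make the pieces nonempty; disjoint nonempty pieces are distinct,
    which yields injectivity.\<close>
  have ne: "x i \<noteq> {}" if "i \<in> {1..n}" for i
    using x(1) v that measure_empty[of M] by metis
  have inj: "inj_on x {1..n}"
    using x(2) ne unfolding inj_on_def disjoint_family_on_def by (metis Int_absorb)
  have "disjoint (x ` {1..n})"
    using x(2) by (rule disjoint_family_on_disjoint_image)
  moreover have "{} \<notin> x ` {1..n}" using ne by (metis imageE)
  ultimately have "clopen_partition (x ` {1..n})"
    using x(1,3) by (auto simp: clopen_partition_def partition_on_def)
  then show "\<exists>x. inj_on x {1..n} \<and> clopen_partition (x ` {1..n}) \<and>
    (\<forall>i\<in>{1..n}. measure M (x i) = v i)" using inj x(1) by blast
next
  \<comment> \<open>The difference is realized by removing from \<open>V\<close> a clopen copy of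
    \<open>U\<close>.\<close>
  have *: "measure M V - measure M U \<in> clopen_values M"
    if UV: "clopen U" "clopen V" "measure M U \<le> measure M V" for U V
  proof -
    obtain W where W: "clopen W" "W \<subseteq> V" "measure M W = measure M U"
      using good_subset_le[OF good UV] by blast
    then have "measure M (V - W) = measure M V - measure M U"
      using UV by (simp add: clopen_in_sets finite_measure_Diff)
    moreover have "clopen (V - W)" using W(1) UV(2) by simp
    ultimately show ?thesis unfolding clopen_values_def mem_Collect_eq by metis
  qed
  fix v w assume "v \<in> clopen_values M" "w \<in> clopen_values M"
  then obtain U V where "clopen U" "v = measure M U" "clopen V" "w = measure M V"
    by (auto simp: clopen_values_def)
  then show "\<bar>v - w\<bar> \<in> clopen_values M"
    using *[of U V] *[of V U] by (cases "v \<le> w") auto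
qed

section \<open>The converse: from ultrahomogeneous and maximal to good\<close>

lemma homeo_image_clopen:
  assumes \<phi>: "\<phi> \<in> homeo M" and U: "clopen U"
  shows "clopen (\<phi> ` U)" "measure M (\<phi> ` U) = measure M U"
proof -
  obtain \<psi> where h: "homeomorphism UNIV UNIV \<phi> \<psi>" and d: "distr M M \<phi> = M"
    using \<phi> by (auto simp: homeo_def)
  have c: "continuous_on UNIV \<phi>" "continuous_on UNIV \<psi>" and inv: "\<And>x. \<psi> (\<phi> x) = x" "\<And>x. \<phi> (\<psi> x) = x"
    using h by (auto simp: homeomorphism_def)
  \<comment> \<open>As a preimage under the continuous inverse, the image is clopen.\<close>
  have im: "\<phi> ` U = \<psi> -` U" using inv by (auto simp: image_iff) metis
  show cl: "clopen (\<phi> ` U)"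
    using U c(2) unfolding im clopen_def by (simp add: open_vimage closed_vimage)
  have meas: "\<phi> \<in> measurable M M"
    using borel_measurable_continuous_onI[OF c(1)] measurable_cong_sets[OF full_sets full_sets] by blast
  have "\<phi> -` \<phi> ` U = U" by (rule inj_vimage_image_eq) (metis inv(1) injI)
  then show "measure M (\<phi> ` U) = measure M U"
    using measure_distr[OF meas clopen_in_sets[OF cl]] d full_space by simp
qed

lemma ultrahomogeneous_maximal_imp_good:
  assumes uh: "ultrahomogeneous M" and mx: "maximal M"
  shows "good M"
  unfolding good_def
proof (intro conjI allI impI full)
  fix U V assume UV: "clopen U \<and> clopen V \<and> measure M U < measure M V"
  have parts: "\<exists>x. inj_on x {1..n} \<and> clopen_partition (x ` {1..n}) \<and> (\<forall>i\<in>{1..n}. measure M (x i) = v i)"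
    if "\<forall>i\<in>{1..n}. v i \<in> clopen_values M \<and> v i \<noteq> 0" "(\<Sum>i=1..n. v i) = 1" for n :: nat and v
    using mx that unfolding maximal_def by blast
  have cv: "measure M X \<in> clopen_values M" if "clopen X" for X
    using that by (auto simp: clopen_values_def)
  have "\<bar>measure M V - measure M U\<bar> \<in> clopen_values M"
    using mx cv UV unfolding maximal_def by blast
  then have diff: "measure M V - measure M U \<in> clopen_values M" using UV by simp
  have compl: "measure M (- V) = 1 - measure M V"
    using finite_measure_Diff[of UNIV V] UV by (simp add: clopen_in_sets measure_UNIV Compl_eq_Diff_UNIV)
  \<comment> \<open>Maximality realizes only nonzero values, so an empty \<open>U\<close> or an
    empty complement of \<open>V\<close> is treated apart.\<close>
  consider "U = {}" | "U \<noteq> {}" "V = UNIV" | "U \<noteq> {}" "V \<noteq> UNIV" by blast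
  then show "\<exists>W. clopen W \<and> W \<subseteq> V \<and> measure M W = measure M U"
  proof cases
    case 1
    then show ?thesis by (intro exI[of _ "{}"]) simp
  next
    case 2
    then show ?thesis using UV by (intro exI[of _ U]) simp
  next
    case 3
    \<comment> \<open>The three values sum to 1; the middle one is nonzero because the inequality is
      strict.\<close>
    define v where "v = (\<lambda>i::nat. if i = 1 then measure M U
      else if i = 2 then measure M V - measure M U else measure M (- V))"
    have 123: "{1..3::nat} = {1, 2, 3}" by auto
    have "\<forall>i\<in>{1..3}. v i \<in> clopen_values M \<and> v i \<noteq> 0"
      using 3 UV diff cv clopen_measure_eq_0_iff[of U] clopen_measure_eq_0_iff[of "- V"]
      by (auto simp: 123 v_def)
    moreover have "(\<Sum>i=1..3. v i) = 1" unfolding 123 by (simp add: v_def compl)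
    ultimately obtain x where x: "inj_on x {1..3::nat}" "clopen_partition (x ` {1..3})"
      "\<forall>i\<in>{1..3}. measure M (x i) = v i"
      using parts by blast
    have P: "clopen_partition {x 1, x 2, x 3}" using x(2) unfolding 123 by simp
    have neq: "x 1 \<noteq> x 2" "x 1 \<noteq> x 3" "x 2 \<noteq> x 3"
      using x(1) unfolding 123 by (simp_all add: inj_on_def)
    have cl: "clopen (x 1)" "clopen (x 2)" "clopen (x 3)"
      and ne: "x 1 \<noteq> {}" "x 3 \<noteq> {}" and un: "x 1 \<union> x 2 \<union> x 3 = UNIV"
      using P by (auto simp: clopen_partition_def partition_on_def)
    have "disjoint {x 1, x 2, x 3}" using P by (simp add: clopen_partition_def partition_on_def)
    then have dj: "x 1 \<inter> x 2 = {}" "x 1 \<inter> x 3 = {}" "x 2 \<inter> x 3 = {}"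
      using neq by (simp_all add: disjoint_def)
    let ?A = "x 1 \<union> x 2"
    have mA: "measure M ?A = measure M V" "measure M (x 3) = measure M (- V)"
      using x(3) cl dj finite_measure_Union[of "x 1" "x 2"] by (auto simp: 123 v_def clopen_in_sets)
    have "V \<noteq> {}" using UV by auto
    \<comment> \<open>Merging the first two cells gives a two-cell partition with the measures of
      \<open>V\<close> and its complement.\<close>
    then have PR: "clopen_partition {?A, x 3}" "clopen_partition {V, - V}"
      using cl ne un dj 3 UV by (auto simp: clopen_partition_def partition_on_def disjoint_def)
    define f where "f = (\<lambda>z. if z = x 3 then - V else V)"
    have A3: "?A \<noteq> x 3" using dj ne by auto
    then have f: "f ?A = V" "f (x 3) = - V" by (auto simp: f_def)
    have "bij_betw f {?A, x 3} {V, - V}"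
      using f A3 unfolding bij_betw_def inj_on_def by auto
    moreover have "\<forall>z\<in>{?A, x 3}. measure M z = measure M (f z)" using mA f by simp
    ultimately have "\<exists>\<phi>\<in>homeo M. \<forall>z\<in>{?A, x 3}. \<phi> ` z = f z"
      using uh[unfolded ultrahomogeneous_def, THEN conjunct2, rule_format, of "{?A, x 3}" "{V, - V}" f] PR
      by blast
    then obtain \<phi> where \<phi>: "\<phi> \<in> homeo M" "\<forall>z\<in>{?A, x 3}. \<phi> ` z = f z" by blast
    \<comment> \<open>\<open>\<phi>\<close> maps \<open>?A\<close> onto \<open>V\<close>, so the
      image of the subcell \<open>x 1\<close> is the required \<open>W\<close>.\<close>
    have "\<phi> ` x 1 \<subseteq> V" using \<phi>(2) f by auto
    moreover have "measure M (x 1) = measure M U" using x(3) by (simp add: 123 v_def)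
    ultimately show ?thesis using homeo_image_clopen[OF \<phi>(1) cl(1)] by metis
  qed
qed

end

theorem theorem1:
  fixes \<mu> :: "(nat \<Rightarrow> bool) measure"
  assumes "full_measure \<mu>"
  shows "good \<mu> \<longleftrightarrow> ultrahomogeneous \<mu> \<and> maximal \<mu>"
  using good_imp_ultrahomogeneous good_imp_maximal ultrahomogeneous_maximal_imp_good assms by blast

end
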